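(* Let $P\in\mathbb{H}[x]$ be a monic polynomial of degree $n\ge 1$ with simple roots, and let $$P(x)=(x-x_n)\ast(x-x_{n-1})\ast\cdots\ast(x-x_1),\qquad x_1,\dots,x_n\in\mathbb{H},$$ be a factorization of $P$ into linear factors. Given initial approximations $z_1^{(0)},\dots,z_n^{(0)}\in\mathbb{H}$, define for $k=0,1,2,\dots$ and, successively, $i=1,\dots,n$, $$z_i^{(k+1)} = z_i^{(k)} - \Bigl(\overline{\mathcal{L}_i^{(k)}}\ast P\ast\overline{\mathcal{R}_i^{(k)}}\Bigr)\bigl(z_i^{(k)}\bigr)\,\Bigl(\boldsymbol{\mathcal{Q}}_i^{(k)}\bigl(z_i^{(k)}\bigr)\Bigr)^{-1},$$ where $$\mathcal{L}_i^{(k)}(x)=\bigl(x-z_n^{(k)}\bigr)\ast\bigl(x-z_{n-1}^{(k)}\bigr)\ast\cdots\ast\bigl(x-z_{i+1}^{(k)}\bigr),$$ $$\mathcal{R}_i^{(k)}(x)=\bigl(x-z_{i-1}^{(k+1)}\bigr)\ast\bigl(x-z_{i-2}^{(k+1)}\bigr)\ast\cdots\ast\bigl(x-z_1^{(k+1)}\bigr),$$ $$\boldsymbol{\mathcal{Q}}_i^{(k)}(x)=\prod_{j=1}^{i-1}\mathcal{Q}_{z_j^{(k+1)}}(x)\,\prod_{j=i+1}^{n}\mathcal{Q}_{z_j^{(k)}}(x)$$ (empty products being equal to $1$). If the initial approximations $z_i^{(0)}$ are sufficiently close to the factor terms $x_i$ ($i=1,\dots,n$), then the sequences $\{z_i^{(k)}\}_k$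 converge quadratically to $x_i$, $i=1,\dots,n$.
   Context: $\mathbb{H}$ is the algebra of real quaternions, with conjugation $q\mapsto\overline{q}$, real part $\operatorname{Re} q$ and norm $|q|=\sqrt{q\overline{q}}$. $\mathbb{H}[x]$ is the ring of left unilateral polynomials $P(x)=\sum_{k=0}^n a_kx^k$, $a_k\in\mathbb{H}$, with the usual addition and with product $$\Bigl(\sum_i a_ix^i\Bigr)\ast\Bigl(\sum_j b_jx^j\Bigr)=\sum_k\Bigl(\sum_{j=0}^k a_jb_{k-j}\Bigr)x^k$$ (so $x$ commutes with coefficients in the product). Evaluation at $q\in\mathbb{H}$ is $P(q)=\sum_k a_kq^k$ (coefficients on the left); it is not a ring homomorphism. In expressions such as $(A\ast P\ast B)(q)$, the product polynomial is formed first and then evaluated at $q$. The conjugate polynomial of $P(x)=\sum_k a_kx^k$ is $\overline{P}(x)=\sum_k\overline{a_k}\,x^k$. For $q\in\mathbb{H}$, the characteristic polynomial of $q$ is the real polynomial $\mathcal{Q}_q(x)=(x-q)\ast(x-\overline{q})=x^2-2(\operatorname{Re}q)\,x+|q|^2$. A zero of $P$ is a $q\in\mathbb{H}$ with $P(q)=0$. The congruence class of $q$ is $[q]=\{hqh^{-1}:h\in\mathbb{H}\setminus\{0\}\}$. A zero $q$ of $P$ is isolated if $[q]$ contains no other zero of $P$. A polynomial $P$ of degree $n$ is said to have simple roots if it has $n$ distinct isolated zeros. Every monic polynomial of degree $n\ge1$ in $\mathbb{H}[x]$ has a factorization into linear factors as in the claim. Meaning of the convergence statement: sequences $\{w_1^{(k)}\},\dots,\{w_n^{(k)}\}$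 converge quadratically to $w_1,\dots,w_n$ if $w_i^{(k)}\to w_i$ for every $i$ and, with $e^{(k)}=\max_i|w_i-w_i^{(k)}|$, one has $e^{(k+1)}=\mathcal{O}\bigl((e^{(k)})^2\bigr)$, i.e. there is a constant $C$ with $e^{(k+1)}\le C\,(e^{(k)})^2$ for all $k$. "Sufficiently close" means that there is $\delta>0$ (depending on $P$ and the factorization) such that the assertion, including well-definedness of all iterates, holds whenever $\max_i|z_i^{(0)}-x_i|<\delta$. *)

theory Defs
  imports "HOL-Analysis.Analysis" "HOL-Computational_Algebra.Polynomial"
begin

section \<open>Real quaternions\<close>

datatype quat = Quat (qre: real) (qi: real) (qj: real) (qk: real)

lemma quat_eq_iff: "p = q \<longleftrightarrow> qre p = qre q \<and> qi p = qi q \<and> qj p = qj q \<and> qk p = qk q"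
  by (cases p; cases q) simp

instantiation quat :: "{ring_1, division_ring, real_algebra_1}"
begin

definition "0 = Quat 0 0 0 0"
definition "1 = Quat 1 0 0 0"
definition "p + q = Quat (qre p + qre q) (qi p + qi q) (qj p + qj q) (qk p + qk q)"
definition "p - q = Quat (qre p - qre q) (qi p - qi q) (qj p - qj q) (qk p - qk q)"
definition "- q = Quat (- qre q) (- qi q) (- qj q) (- qk q)"
definition "p * q = Quat
  (qre p * qre q - qi p * qi q - qj p * qj q - qk p * qk q)
  (qre p * qi q + qi p * qre q + qj p * qk q - qk p * qj q)
  (qre p * qj q - qi p * qk q + qj p * qre q + qk p * qi q)
  (qre p * qk q + qi p * qj q - qj p * qi q + qk p * qre q)"
definition "c *\<^sub>R q = Quat (c * qre q) (c * qi q) (c * qj q) (c * qk q)"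
definition "inverse q =
  (let s = (qre q)\<^sup>2 + (qi q)\<^sup>2 + (qj q)\<^sup>2 + (qk q)\<^sup>2
   in Quat (qre q / s) (- qi q / s) (- qj q / s) (- qk q / s))"
definition "p div q = p * inverse q" for p q :: quat

lemmas quat_ring_defs = zero_quat_def one_quat_def plus_quat_def minus_quat_def
  uminus_quat_def times_quat_def scaleR_quat_def

lemma quat_sumsq_nonzero:
  "q \<noteq> 0 \<Longrightarrow> (qre q)\<^sup>2 + (qi q)\<^sup>2 + (qj q)\<^sup>2 + (qk q)\<^sup>2 \<noteq> 0"
  by (auto simp: quat_eq_iff zero_quat_def add_nonneg_eq_0_iff)

instance
proof
  fix q :: quat
  assume "q \<noteq> 0"
  from quat_sumsq_nonzero[OF this]
  show "inverse q * q = 1" "q * inverse q = 1"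
    by (simp_all add: inverse_quat_def Let_def quat_eq_iff quat_ring_defs
        add_divide_distrib[symmetric] diff_divide_distrib[symmetric] power2_eq_square)
qed (simp_all add: quat_eq_iff quat_ring_defs divide_quat_def inverse_quat_def algebra_simps)

end

instantiation quat :: real_inner
begin

definition "inner p q = qre p * qre q + qi p * qi q + qj p * qj q + qk p * qk q"
definition "norm q = sqrt ((qre q)\<^sup>2 + (qi q)\<^sup>2 + (qj q)\<^sup>2 + (qk q)\<^sup>2)"
definition "sgn q = q /\<^sub>R norm q" for q :: quat
definition "dist p q = norm (p - q)" for p q :: quat
definition "(uniformity :: (quat \<times> quat) filter) =
  (INF e\<in>{0<..}. principal {(p, q). dist p q < e})"
definition "open U \<longleftrightarrow>
  (\<forall>p\<in>U. eventually (\<lambda>(p', q). p' = p \<longrightarrow> q \<in> U) uniformity)" for U :: "quat set"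

instance
proof
  fix p :: quat
  show "0 \<le> inner p p" by (simp add: inner_quat_def)
  show "inner p p = 0 \<longleftrightarrow> p = 0"
    using quat_sumsq_nonzero[of p]
    by (auto simp: inner_quat_def zero_quat_def power2_eq_square)
qed (simp_all add: inner_quat_def norm_quat_def sgn_quat_def dist_quat_def
    uniformity_quat_def open_quat_def quat_ring_defs algebra_simps power2_eq_square)

end

instance quat :: real_normed_div_algebra
proof
  fix p q :: quat
  show "norm (p * q) = norm p * norm q"
    unfolding norm_quat_def real_sqrt_mult[symmetric]
    by (rule arg_cong[where f = sqrt])
      (simp add: times_quat_def power2_eq_square algebra_simps)
qed

definition qcnj :: "quat \<Rightarrow> quat" where
  "qcnj q = Quat (qre q) (- qi q) (- qj q) (- qk q)"

lemma mult_qcnj: "q * qcnj q = of_real ((norm q)\<^sup>2)"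
  by (simp add: of_real_def norm_quat_def quat_eq_iff qcnj_def quat_ring_defs
      power2_eq_square)

definition congruence_class :: "quat \<Rightarrow> quat set" where
  "congruence_class q = {h * q * inverse h | h. h \<noteq> 0}"


section \<open>Left unilateral quaternionic polynomials\<close>

text \<open>
  The library product on \<^typ>\<open>'a poly\<close> and the evaluation function \<^const>\<open>poly\<close> require a
  commutative coefficient ring, so both are defined here: the product is convolution of the
  coefficient sequences, and evaluation puts the coefficients on the left.
\<close>

lift_definition pmult :: "'a::semiring_0 poly \<Rightarrow> 'a poly \<Rightarrow> 'a poly"  (infixl "\<star>" 70)
  is "\<lambda>a b k. \<Sum>j\<le>k. a j * b (k - j)"
proof -
  fix a b :: "nat \<Rightarrow> 'a"
  assume "\<forall>\<^sub>\<infinity>k. a k = 0" "\<forall>\<^sub>\<infinity>k. b k = 0"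
  then obtain m n where a: "\<And>k. k > m \<Longrightarrow> a k = 0" and b: "\<And>k. k > n \<Longrightarrow> b k = 0"
    unfolding MOST_nat by blast
  have "(\<Sum>j\<le>k. a j * b (k - j)) = 0" if "k > m + n" for k
  proof (rule sum.neutral, rule ballI)
    fix j
    have "j > m \<or> k - j > n" using that by linarith
    then show "a j * b (k - j) = 0" using a b by auto
  qed
  then show "\<forall>\<^sub>\<infinity>k. (\<Sum>j\<le>k. a j * b (k - j)) = 0"
    unfolding MOST_nat by blast
qed

definition peval :: "'a::{semiring_0, monoid_mult} poly \<Rightarrow> 'a \<Rightarrow> 'a" where
  "peval P q = (\<Sum>k\<le>degree P. coeff P k * q ^ k)"

definition pcnj :: "quat poly \<Rightarrow> quat poly" where
  "pcnj P = map_poly qcnj P"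

definition pprod :: "quat poly list \<Rightarrow> quat poly" where
  "pprod Ps = foldr (\<star>) Ps [:1:]"

definition linear_factor :: "quat \<Rightarrow> quat poly" where
  "linear_factor q = [:- q, 1:]"

definition char_poly :: "quat \<Rightarrow> quat poly" where
  "char_poly q = linear_factor q \<star> linear_factor (qcnj q)"

lemma char_poly_explicit:
  "char_poly q = [:of_real ((norm q)\<^sup>2), of_real (- 2 * qre q), 1:]"
proof (rule poly_eqI)
  fix k
  have 1: "- q - qcnj q = of_real (- 2 * qre q)"
    by (simp add: of_real_def quat_eq_iff qcnj_def quat_ring_defs)
  have lin: "coeff (linear_factor r) j = (if j = 0 then - r else if j = 1 then 1 else 0)"
    for r and j
    by (simp add: linear_factor_def coeff_pCons split: nat.split)
  consider "k = 0" | "k = 1" | "k = 2" | m where "k = Suc (Suc (Suc m))"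
    by (metis One_nat_def Suc_1 not0_implies_Suc)
  then show "coeff (char_poly q) k
    = coeff [:of_real ((norm q)\<^sup>2), of_real (- 2 * qre q), 1:] k"
  proof cases
    case 1
    then show ?thesis by (simp add: char_poly_def pmult.rep_eq lin mult_qcnj)
  next
    case 2
    then show ?thesis using 1 by (simp add: char_poly_def pmult.rep_eq lin)
  next
    case 3
    then show ?thesis by (simp add: char_poly_def pmult.rep_eq lin numeral_2_eq_2)
  next
    case 4
    have "coeff (linear_factor q) j * coeff (linear_factor (qcnj q)) (k - j) = 0" for j
      using 4 by (simp add: lin)
    then have "coeff (char_poly q) k = 0"
      unfolding char_poly_def pmult.rep_eq by (intro sum.neutral) blast
    then show ?thesis using 4 by simp
  qed
qed

definition is_zero :: "quat poly \<Rightarrow> quat \<Rightarrow> bool" where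
  "is_zero P q \<longleftrightarrow> peval P q = 0"

definition isolated_zero :: "quat poly \<Rightarrow> quat \<Rightarrow> bool" where
  "isolated_zero P q \<longleftrightarrow> is_zero P q \<and> (\<forall>r\<in>congruence_class q. is_zero P r \<longrightarrow> r = q)"

definition simple_roots :: "quat poly \<Rightarrow> bool" where
  "simple_roots P \<longleftrightarrow>
    (\<exists>S. finite S \<and> card S = degree P \<and> (\<forall>q\<in>S. isolated_zero P q))"


section \<open>The iteration\<close>

text \<open>Families \<open>z\<^sub>1, \<dots>, z\<^sub>n\<close> are functions on \<^typ>\<open>nat\<close> of which only the indices
  \<open>1, \<dots>, n\<close> matter. In the products of linear factors the indices decrease from left to right.\<close>

definition factor_product :: "nat \<Rightarrow> (nat \<Rightarrow> quat) \<Rightarrow> quat poly" where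
  "factor_product n x = pprod (map (\<lambda>j. linear_factor (x j)) (rev [1..<Suc n]))"

definition left_part :: "nat \<Rightarrow> (nat \<Rightarrow> quat) \<Rightarrow> nat \<Rightarrow> quat poly" where
  "left_part n z i = pprod (map (\<lambda>j. linear_factor (z j)) (rev [Suc i..<Suc n]))"

definition right_part :: "(nat \<Rightarrow> quat) \<Rightarrow> nat \<Rightarrow> quat poly" where
  "right_part w i = pprod (map (\<lambda>j. linear_factor (w j)) (rev [1..<i]))"

definition char_part :: "nat \<Rightarrow> (nat \<Rightarrow> quat) \<Rightarrow> (nat \<Rightarrow> quat) \<Rightarrow> nat \<Rightarrow> quat poly" where
  "char_part n z w i =
     pprod (map (\<lambda>j. char_poly (w j)) [1..<i]) \<star>
     pprod (map (\<lambda>j. char_poly (z j)) [Suc i..<Suc n])"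

text \<open>
  Congruence rules for the termination proof of \<open>iterate\<close>: only the values \<open>w j\<close> with \<open>j < i\<close>
  are used.
\<close>

lemma right_part_cong [fundef_cong]:
  "\<lbrakk>i = i'; \<And>j. j < i' \<Longrightarrow> w j = w' j\<rbrakk> \<Longrightarrow> right_part w i = right_part w' i'"
  unfolding right_part_def by (intro arg_cong[where f = pprod] map_cong) auto

lemma char_part_cong [fundef_cong]:
  "\<lbrakk>n = n'; z = z'; i = i'; \<And>j. j < i' \<Longrightarrow> w j = w' j\<rbrakk>
    \<Longrightarrow> char_part n z w i = char_part n' z' w' i'"
  unfolding char_part_def
  by (intro arg_cong2[where f = "(\<star>)"] arg_cong[where f = pprod] map_cong) auto

text \<open>
  \<open>iterate P n z\<^sub>0 k i\<close> is \<open>z\<^sub>i\<^sup>(\<^sup>k\<^sup>)\<close>. As \<open>inverse 0 = 0\<close>, the function is total; an iterate is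
  well defined in the mathematical sense iff \<open>denominator\<close> below does not vanish.
\<close>

function iterate :: "quat poly \<Rightarrow> nat \<Rightarrow> (nat \<Rightarrow> quat) \<Rightarrow> nat \<Rightarrow> nat \<Rightarrow> quat" where
  "iterate P n z0 0 i = z0 i"
| "iterate P n z0 (Suc k) i =
     iterate P n z0 k i
     - peval (pcnj (left_part n (\<lambda>j. iterate P n z0 k j) i) \<star> P
              \<star> pcnj (right_part (\<lambda>j. iterate P n z0 (Suc k) j) i))
         (iterate P n z0 k i)
       * inverse (peval (char_part n (\<lambda>j. iterate P n z0 k j)
                           (\<lambda>j. iterate P n z0 (Suc k) j) i)
                    (iterate P n z0 k i))"
  by pat_completeness auto
termination
  by (relation "inv_image (less_than <*lex*> less_than) (\<lambda>(P, n, z0, k, i). (k, i))") auto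

definition denominator :: "quat poly \<Rightarrow> nat \<Rightarrow> (nat \<Rightarrow> quat) \<Rightarrow> nat \<Rightarrow> nat \<Rightarrow> quat" where
  "denominator P n z0 k i =
     peval (char_part n (iterate P n z0 k) (iterate P n z0 (Suc k)) i) (iterate P n z0 k i)"

definition max_error :: "nat \<Rightarrow> (nat \<Rightarrow> quat) \<Rightarrow> (nat \<Rightarrow> quat) \<Rightarrow> real" where
  "max_error n w v = Max ((\<lambda>i. norm (w i - v i)) ` {1..n})"

definition converges_quadratically ::
    "nat \<Rightarrow> (nat \<Rightarrow> nat \<Rightarrow> quat) \<Rightarrow> (nat \<Rightarrow> quat) \<Rightarrow> bool" where
  "converges_quadratically n z w \<longleftrightarrow>
     (\<forall>i\<in>{1..n}. (\<lambda>k. z k i) \<longlonglongrightarrow> w i) \<and>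
     (\<exists>C. \<forall>k. max_error n w (z (Suc k)) \<le> C * (max_error n w (z k))\<^sup>2)"

end

theory Submission
  imports Defs
begin

text \<open>
  The linear factors can be stripped off \<open>P\<close> only from the outside, so \<open>P\<close> is multiplied by
  conjugates of the approximate factors on both sides. If all other approximations were exact, the
  product would be the real polynomial \<open>Q\<close> (the product of the other characteristic
  polynomials) times \<open>x - x\<^sub>i\<close>, and one step would return \<open>x\<^sub>i\<close> exactly. In general the numerator
  differs from \<open>(z\<^sub>i - x\<^sub>i) Q(z\<^sub>i)\<close> by at most \<open>C (e\<^sup>2 + e')\<close>, where \<open>e\<close> bounds the old errors
  and \<open>e'\<close> the errors of the already updated \<open>z\<^sub>1, \<dots>, z\<^sub>i\<^sub>-\<^sub>1\<close>. By induction on \<open>i\<close> all the new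
  errors are \<open>O(e\<^sup>2)\<close>.

  The denominators stay away from \<open>0\<close> because \<open>x\<^sub>1, \<dots>, x\<^sub>n\<close> are pairwise non-congruent: every zero
  of \<open>P\<close> is congruent to some \<open>x\<^sub>j\<close>, and the \<open>n\<close> isolated zeros lie in \<open>n\<close> distinct classes.
\<close>

section \<open>Conjugation and congruence classes\<close>

lemma qcnj_simps [simp]:
  "qcnj 0 = 0" "qcnj 1 = 1" "qcnj (- p) = - qcnj p" "qcnj (qcnj p) = p"
  "norm (qcnj p) = norm p" "qre (qcnj p) = qre p"
  by (simp_all add: qcnj_def quat_eq_iff quat_ring_defs norm_quat_def)

lemma qcnj_add: "qcnj (p + q) = qcnj p + qcnj q"
  by (simp add: qcnj_def quat_eq_iff quat_ring_defs)

lemma qcnj_mult: "qcnj (p * q) = qcnj q * qcnj p"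
  by (simp add: qcnj_def quat_eq_iff quat_ring_defs algebra_simps)

lemma qcnj_sum: "qcnj (sum f A) = (\<Sum>a\<in>A. qcnj (f a))"
  by (induction A rule: infinite_finite_induct) (auto simp: qcnj_add)

text \<open>Value at \<open>q\<close> of the characteristic polynomial of \<open>a\<close>. Its
  coefficients are real, so the side on which they stand is immaterial.\<close>

definition char_val :: "quat \<Rightarrow> quat \<Rightarrow> quat" where
  "char_val q a = q * q - (2 * qre a) *\<^sub>R q + (norm a)\<^sup>2 *\<^sub>R 1"

lemma char_val_qcnj [simp]: "char_val q (qcnj a) = char_val q a"
  by (simp add: char_val_def)

lemma norm_quat_sq: "norm q * norm q = qre q * qre q + qi q * qi q + qj q * qj q + qk q * qk q"
  by (simp add: norm_quat_def flip: power2_eq_square)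

text \<open>The imaginary components of the value are those of \<open>q\<close> times 2 (Re q - Re
  a). So either the real parts agree, or \<open>q\<close> is real and the value (q - Re a)^2 + |Im
  a|^2 is positive. Conversely, \<open>q\<close> is a zero of its own characteristic polynomial,
  which depends only on real part and norm.\<close>

lemma char_val_eq_0_iff: "char_val q a = 0 \<longleftrightarrow> qre q = qre a \<and> norm q = norm a"
proof
  assume "char_val q a = 0"
  then have re: "(qre q)\<^sup>2 - (qi q)\<^sup>2 - (qj q)\<^sup>2 - (qk q)\<^sup>2 - 2 * qre a * qre q + (norm a)\<^sup>2 = 0"
    and im: "(qre q - qre a) * qi q = 0" "(qre q - qre a) * qj q = 0" "(qre q - qre a) * qk q = 0"
    by (simp_all add: char_val_def quat_eq_iff quat_ring_defs power2_eq_square algebra_simps)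
  have re_eq: "qre q = qre a"
  proof (rule ccontr)
    assume ne: "qre q \<noteq> qre a"
    with im have "qi q = 0" "qj q = 0" "qk q = 0" by auto
    with re have "(qre q - qre a)\<^sup>2 + (qi a)\<^sup>2 + (qj a)\<^sup>2 + (qk a)\<^sup>2 = 0"
      by (simp add: norm_quat_sq power2_eq_square algebra_simps)
    then have "(qre q - qre a)\<^sup>2 = 0"
      by (smt (verit) zero_le_power2)
    with ne show False by simp
  qed
  with re have "(norm q)\<^sup>2 = (norm a)\<^sup>2"
    by (simp add: norm_quat_sq power2_eq_square algebra_simps)
  with re_eq show "qre q = qre a \<and> norm q = norm a"
    by simp
next
  assume "qre q = qre a \<and> norm q = norm a"
  then have "char_val q a = q * q - (2 * qre q) *\<^sub>R q + (norm q)\<^sup>2 *\<^sub>R 1"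
    by (simp add: char_val_def)
  also have "\<dots> = 0"
    by (simp add: norm_quat_sq quat_eq_iff quat_ring_defs power2_eq_square algebra_simps)
  finally show "char_val q a = 0" .
qed

lemma mem_congruence_classI:
  assumes "qre p = qre q" "norm p = norm q"
  shows "p \<in> congruence_class q"
proof -
  have "\<exists>h. h \<noteq> 0 \<and> h * q = p * h"
  proof (cases "p = qcnj q")
    case False
    \<comment> \<open>With the conjugator \<open>p - qcnj q\<close> the two sides differ, up to
      sign, by the value at \<open>p\<close> of the characteristic polynomial of \<open>q\<close>,
      which is 0.\<close>
    have "(norm p)\<^sup>2 = (norm q)\<^sup>2" using assms by simp
    then have "(p - qcnj q) * q = p * (p - qcnj q)"
      using assms(1)
      by (simp add: norm_quat_sq quat_eq_iff quat_ring_defs qcnj_def power2_eq_square algebra_simps)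
    with False show ?thesis by (intro exI[of _ "p - qcnj q"]) simp
  next
    case True
    show ?thesis
    \<comment> \<open>Now \<open>p - qcnj q\<close> vanishes. A nonzero imaginary \<open>h\<close>
      orthogonal to the imaginary part of \<open>q\<close> anticommutes with it, so it satisfies
      \<open>h * q = qcnj q * h\<close>. Both witnesses are of this kind.\<close>
    proof (cases "qi q = 0 \<and> qj q = 0")
      case True
      then show ?thesis using \<open>p = qcnj q\<close>
        by (intro exI[of _ "Quat 0 1 0 0"]) (simp add: quat_eq_iff quat_ring_defs qcnj_def)
    next
      case False
      then show ?thesis using \<open>p = qcnj q\<close>
        by (intro exI[of _ "Quat 0 (- qj q) (qi q) 0"])
          (auto simp: quat_eq_iff quat_ring_defs qcnj_def)
    qed
  qed
  then obtain h where h: "h \<noteq> 0" "h * q = p * h" by blast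
  then have "p = h * q * inverse h"
    by (simp add: mult.assoc)
  with h(1) show ?thesis
    unfolding congruence_class_def by blast
qed

lemma isCont_char_val: "isCont (\<lambda>p. char_val (fst p) (snd p)) p"
proof -
  \<comment> \<open>Written as an inner product, the real part is covered by the standard continuity
    rules.\<close>
  have "qre a = inner a 1" for a
    by (simp add: inner_quat_def one_quat_def)
  then show ?thesis
    unfolding char_val_def by (simp add: power2_norm_eq_inner)
qed

section \<open>Evaluation of products of linear factors\<close>

lemma pmult_assoc: "(A \<star> B) \<star> C = A \<star> (B \<star> C)"
proof (rule poly_eqI)
  fix k
  \<comment> \<open>Associativity is transferred from formal power series, whose product is the same
    convolution and is associative over noncommutative coefficients too.\<close>
  have "(Abs_fps (coeff A) * Abs_fps (coeff B)) * Abs_fps (coeff C)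
      = Abs_fps (coeff A) * (Abs_fps (coeff B) * Abs_fps (coeff C))"
    by (rule mult.assoc)
  then have "fps_nth ((Abs_fps (coeff A) * Abs_fps (coeff B)) * Abs_fps (coeff C)) k
      = fps_nth (Abs_fps (coeff A) * (Abs_fps (coeff B) * Abs_fps (coeff C))) k"
    by simp
  then show "coeff ((A \<star> B) \<star> C) k = coeff (A \<star> (B \<star> C)) k"
    by (simp add: pmult.rep_eq fps_mult_nth atMost_atLeast0)
qed

lemma pmult_one_left [simp]: "[:1:] \<star> A = A" for A :: "'a::semiring_1 poly"
proof (rule poly_eqI)
  fix k
  have "coeff ([:1:] \<star> A) k = (\<Sum>j\<le>k. if j = 0 then coeff A k else 0)"
    unfolding pmult.rep_eq by (intro sum.cong) (auto simp: coeff_pCons split: nat.split)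
  then show "coeff ([:1:] \<star> A) k = coeff A k" by simp
qed

lemma pmult_one_right [simp]: "A \<star> [:1:] = A" for A :: "'a::semiring_1 poly"
proof (rule poly_eqI)
  fix k
  have "coeff (A \<star> [:1:]) k = (\<Sum>j\<le>k. if j = k then coeff A k else 0)"
    unfolding pmult.rep_eq by (intro sum.cong) (auto simp: coeff_pCons split: nat.split)
  then show "coeff (A \<star> [:1:]) k = coeff A k" by simp
qed

lemma pprod_append: "pprod (Ps @ Qs) = pprod Ps \<star> pprod Qs"
  by (induction Ps) (simp_all add: pprod_def pmult_assoc)

lemma pcnj_pmult: "pcnj (A \<star> B) = pcnj B \<star> pcnj A"
proof (rule poly_eqI)
  fix k
  have "(\<Sum>j\<le>k. qcnj (coeff B (k - j)) * qcnj (coeff A j))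
      = (\<Sum>j\<le>k. qcnj (coeff B j) * qcnj (coeff A (k - j)))"
    by (rule sum.reindex_bij_witness[of _ "\<lambda>j. k - j" "\<lambda>j. k - j"]) auto
  then show "coeff (pcnj (A \<star> B)) k = coeff (pcnj B \<star> pcnj A) k"
    by (simp add: pcnj_def coeff_map_poly pmult.rep_eq qcnj_sum qcnj_mult)
qed

lemma pcnj_linear_factor: "pcnj (linear_factor a) = linear_factor (qcnj a)"
  by (rule poly_eqI)
    (simp add: pcnj_def linear_factor_def coeff_map_poly coeff_pCons split: nat.split)

lemma coeff_linear_factor_pmult:
  "coeff (linear_factor a \<star> B) k = (case k of 0 \<Rightarrow> 0 | Suc m \<Rightarrow> coeff B m) - a * coeff B k"
proof (cases k)
  case 0
  then show ?thesis by (simp add: pmult.rep_eq linear_factor_def)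
next
  case (Suc m)
  have "coeff (linear_factor a \<star> B) k
      = (\<Sum>j\<le>m. coeff (linear_factor a) (Suc j) * coeff B (m - j)) - a * coeff B k"
    unfolding pmult.rep_eq Suc sum.atMost_Suc_shift by (simp add: linear_factor_def)
  also have "(\<Sum>j\<le>m. coeff (linear_factor a) (Suc j) * coeff B (m - j))
      = (\<Sum>j\<le>m. if j = 0 then coeff B m else 0)"
    by (intro sum.cong) (auto simp: linear_factor_def coeff_pCons split: nat.split)
  finally show ?thesis using Suc by simp
qed

lemma peval_eq_sum:
  assumes "degree P \<le> N"
  shows "peval P q = (\<Sum>k\<le>N. coeff P k * q ^ k)"
  unfolding peval_def using assms
  by (intro sum.mono_neutral_left) (auto simp: coeff_eq_0)

text \<open>Since x commutes with coefficients in the product, a left factor x turns up in the value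
  as \<open>q\<close> on the far right, whereas the constant \<open>a\<close> stays on the
  left.\<close>

lemma peval_linear_factor_pmult:
  "peval (linear_factor a \<star> B) q = peval B q * q - a * peval B q"
proof -
  define N where "N = degree B"
  have z: "coeff B (Suc N) = 0" by (simp add: N_def coeff_eq_0)
  have "degree (linear_factor a \<star> B) \<le> Suc N"
    by (rule degree_le)
      (auto simp: coeff_linear_factor_pmult N_def coeff_eq_0 split: nat.split)
  then have "peval (linear_factor a \<star> B) q = (\<Sum>k\<le>Suc N. coeff (linear_factor a \<star> B) k * q ^ k)"
    by (rule peval_eq_sum)
  also have "\<dots> = (\<Sum>k\<le>Suc N. (case k of 0 \<Rightarrow> 0 | Suc m \<Rightarrow> coeff B m) * q ^ k)
      - (\<Sum>k\<le>Suc N. a * (coeff B k * q ^ k))"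
    by (simp only: coeff_linear_factor_pmult left_diff_distrib sum_subtractf mult.assoc)
  also have "(\<Sum>k\<le>Suc N. (case k of 0 \<Rightarrow> 0 | Suc m \<Rightarrow> coeff B m) * q ^ k)
      = (\<Sum>k\<le>N. coeff B k * q ^ k) * q"
    unfolding sum.atMost_Suc_shift by (simp add: sum_distrib_right power_commutes mult.assoc)
  also have "(\<Sum>k\<le>Suc N. a * (coeff B k * q ^ k)) = a * (\<Sum>k\<le>N. coeff B k * q ^ k)"
    by (simp add: z sum_distrib_left)
  finally show ?thesis by (simp add: peval_def N_def)
qed

section \<open>Products of linear factors as compositions of additive maps\<close>

definition factors :: "quat list \<Rightarrow> quat poly" where
  "factors as = pprod (map linear_factor as)"

lemma factors_append: "factors (as @ bs) = factors as \<star> factors bs"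
  by (simp add: factors_def pprod_append)

lemma factors_Cons: "factors (a # as) = linear_factor a \<star> factors as"
  by (simp add: factors_def pprod_def)

lemma pcnj_factors: "pcnj (factors as) = factors (map qcnj (rev as))"
proof (induction as)
  case Nil
  show ?case
    by (rule poly_eqI)
      (simp add: factors_def pprod_def pcnj_def coeff_map_poly coeff_pCons split: nat.split)
next
  case (Cons a as)
  have "factors [qcnj a] = linear_factor (qcnj a)"
    by (simp add: factors_def pprod_def)
  with Cons show ?case
    by (simp add: factors_Cons pcnj_pmult pcnj_linear_factor factors_append)
qed

text \<open>Multiplying a polynomial by \<open>x - a\<close> on the left changes its value \<open>v\<close> at \<open>q\<close> to
  \<open>v q - a v\<close>, so a product of linear factors is evaluated by iterating these additive maps.\<close>

definition lin :: "quat \<Rightarrow> quat \<Rightarrow> quat \<Rightarrow> quat" where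
  "lin q a v = v * q - a * v"

abbreviation lins :: "quat \<Rightarrow> quat list \<Rightarrow> quat \<Rightarrow> quat" where
  "lins q as \<equiv> foldr (lin q) as"

lemma peval_factors: "peval (factors as) q = lins q as 1"
proof (induction as)
  case Nil
  show ?case by (simp add: factors_def pprod_def peval_def)
qed (simp add: factors_Cons peval_linear_factor_pmult lin_def)

lemma lin_diff: "lin q a (u - v) = lin q a u - lin q a v"
  by (simp add: lin_def algebra_simps)

lemma lins_diff: "lins q as (u - v) = lins q as u - lins q as v"
  by (induction as) (simp_all add: lin_diff)

lemma lins_0 [simp]: "lins q as 0 = 0"
  by (induction as) (simp_all add: lin_def)

lemma lin_mult_commute:
  assumes "q * c = c * q"
  shows "lin q a (v * c) = lin q a v * c"
  using assms by (simp add: lin_def algebra_simps)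

text \<open>The left-hand side is v q^2 - (a + qcnj a) v q + |a|^2 v, and the real numbers a + qcnj
  a and |a|^2 can be moved past \<open>v\<close>.\<close>

lemma lin_lin_qcnj: "lin q a (lin q (qcnj a) v) = v * char_val q a"
  by (simp add: lin_def char_val_def norm_quat_sq quat_eq_iff quat_ring_defs qcnj_def
      power2_eq_square algebra_simps)

lemma char_val_commute:
  assumes "q * c = c * q"
  shows "char_val q a * c = c * char_val q a"
proof -
  have "q * q * c = c * (q * q)"
    using assms by (metis mult.assoc)
  with assms show ?thesis by (simp add: char_val_def algebra_simps)
qed

abbreviation char_prod :: "quat \<Rightarrow> quat list \<Rightarrow> quat" where
  "char_prod q as \<equiv> prod_list (map (char_val q) as)"

lemma char_prod_commute: "q * char_prod q as = char_prod q as * q"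
proof (induction as)
  case (Cons a as)
  have "q * char_val q a = char_val q a * q"
    by (simp add: char_val_commute)
  with Cons show ?case
    by (simp add: mult.assoc) (metis mult.assoc)
qed simp

lemma char_prod_rev: "char_prod q (rev as) = char_prod q as"
  by (induction as) (simp_all add: char_val_commute char_prod_commute)

text \<open>The conjugate pairs collapse from the inside. Each leaves a right factor that commutes
  with \<open>q\<close> and therefore passes through the remaining maps by
  \<open>lin_mult_commute\<close>.\<close>

lemma lins_lins_qcnj: "lins q as (lins q (map qcnj (rev as)) v) = v * char_prod q as"
  by (induction as arbitrary: v)
    (simp_all add: lin_mult_commute char_prod_commute lin_lin_qcnj mult.assoc)

lemma lins_qcnj_lins: "lins q (map qcnj (rev as)) (lins q as v) = v * char_prod q as"
proof -
  have "char_prod q (map qcnj (rev as)) = char_prod q as"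
    by (simp add: o_def char_prod_rev)
  with lins_lins_qcnj[of q "map qcnj (rev as)" v] show ?thesis
    by (simp add: rev_map o_def)
qed

text \<open>Evaluation is multiplicative here, although not in general, because the characteristic
  polynomials have real coefficients.\<close>

lemma peval_char_prod: "peval (pprod (map char_poly as)) q = char_prod q as"
proof (induction as)
  case Nil
  show ?case by (simp add: pprod_def peval_def)
next
  case (Cons a as)
  then show ?case
    by (simp add: pprod_def char_poly_def pmult_assoc peval_linear_factor_pmult
        flip: lin_def)
      (simp add: lin_lin_qcnj char_val_commute char_prod_commute)
qed

section \<open>Simple roots\<close>

text \<open>Applying the conjugate factors in reverse order to the value 0 gives a vanishing product
  of characteristic values, and there are no zero divisors.\<close>

lemma is_zero_factors:
  assumes "is_zero (factors as) q"
  shows "\<exists>a\<in>set as. char_val q a = 0"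
proof -
  have "lins q as 1 = 0"
    using assms by (simp add: is_zero_def peval_factors)
  then have "char_prod q as = 0"
    using lins_qcnj_lins[of q as 1] by simp
  then show ?thesis by (auto simp: prod_list_zero_iff)
qed

text \<open>The \<open>x i\<close> need not be zeros of \<open>P\<close>, so isolation cannot be
  applied to them directly. Instead, \<open>f\<close> sends each isolated zero to an index whose
  factor term is congruent to it. It is injective because congruent isolated zeros coincide, hence
  onto by counting. Congruent \<open>x i\<close> and \<open>x j\<close> would then have the same
  preimage.\<close>

lemma simple_roots_pairwise_char_val:
  assumes P: "P = factors (map x (rev [1..<Suc n]))" "degree P = n" "simple_roots P"
  shows "pairwise (\<lambda>i j. char_val (x i) (x j) \<noteq> 0) {1..n}"
proof (intro pairwiseI notI)
  fix i j
  assume ij: "i \<in> {1..n}" "j \<in> {1..n}" "i \<noteq> j" and 0: "char_val (x i) (x j) = 0"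
  obtain S where S: "finite S" "card S = n" and iso: "\<And>q. q \<in> S \<Longrightarrow> isolated_zero P q"
    using P by (auto simp: simple_roots_def)
  have "\<exists>j\<in>{1..n}. char_val q (x j) = 0" if "q \<in> S" for q
    using is_zero_factors[of "map x (rev [1..<Suc n])" q] iso[OF that] P(1)
    by (auto simp: isolated_zero_def)
  then obtain f where f: "\<And>q. q \<in> S \<Longrightarrow> f q \<in> {1..n}"
      "\<And>q. q \<in> S \<Longrightarrow> char_val q (x (f q)) = 0"
    by metis
  have eq: "p = q" if "p \<in> S" "q \<in> S" "qre p = qre q" "norm p = norm q" for p q
    using iso[OF that(1)] iso[OF that(2)] mem_congruence_classI[OF that(3,4)]
    by (auto simp: isolated_zero_def)
  have "inj_on f S"
    by (rule inj_onI, rule eq) (metis f(2) char_val_eq_0_iff)+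
  then have "f ` S = {1..n}"
    using S f(1) by (intro card_subset_eq) (auto simp: card_image)
  then obtain p q where pq: "p \<in> S" "f p = i" "q \<in> S" "f q = j"
    using ij by (metis imageE)
  then have "p = q"
    using f(2)[of p] f(2)[of q] 0 by (intro eq) (auto simp: char_val_eq_0_iff)
  with pq ij show False by simp
qed

section \<open>Lower bounds for the denominators\<close>

lemma char_val_lower_bound:
  assumes "char_val q0 a0 \<noteq> 0"
  shows "\<forall>\<^sub>F d in at_right 0. \<forall>q a. norm (q - q0) < d \<longrightarrow> norm (a - a0) < d \<longrightarrow>
           d \<le> norm (char_val q a)"
proof -
  define c where "c = norm (char_val q0 a0) / 2"
  have c: "c > 0" using assms by (simp add: c_def)
  obtain r where r: "r > 0" and r_bound: "\<And>p. dist p (q0, a0) < r \<Longrightarrow>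
      dist (char_val (fst p) (snd p)) (char_val q0 a0) < c"
    using isCont_char_val[of "(q0, a0)"] c unfolding continuous_at_eps_delta
    by (metis fst_conv snd_conv)
  have "d \<le> norm (char_val q a)"
    \<comment> \<open>Radius r/2 in each argument keeps the pair within \<open>r\<close>, and the
      value, of norm 2c at the centre, then keeps norm above c > d. So one \<open>d\<close> serves
      as radius and as lower bound.\<close>
    if d: "0 < d" "d < min c (r / 2)" and qa: "norm (q - q0) < d" "norm (a - a0) < d" for d q a
  proof -
    have "dist (q, a) (q0, a0) \<le> norm (q - q0) + norm (a - a0)"
      by (simp add: dist_norm norm_Pair_le)
    then have "dist (char_val q a) (char_val q0 a0) < c"
      using r_bound[of "(q, a)"] d qa by simp
    then have "norm (char_val q0 a0) < norm (char_val q a) + c"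
      by norm
    then show ?thesis using d by (simp add: c_def)
  qed
  then show ?thesis
    unfolding eventually_at_right_field using c r
    by (intro exI[of _ "min c (r / 2)"]) auto
qed

lemma norm_char_prod_ge:
  assumes "0 \<le> d" "\<And>a. a \<in> set as \<Longrightarrow> d \<le> norm (char_val q a)"
  shows "d ^ length as \<le> norm (char_prod q as)"
  using assms(2) by (induction as) (auto simp: norm_mult assms(1) intro!: mult_mono)

section \<open>One step of the iteration\<close>

lemma norm_lins_le:
  assumes "\<And>a. a \<in> set as \<Longrightarrow> norm q + norm a \<le> K" "0 \<le> K"
  shows "norm (lins q as v) \<le> K ^ length as * norm v"
  using assms(1)
proof (induction as)
  case (Cons a as)
  have "norm (lin q a u) \<le> (norm q + norm a) * norm u" for u
    unfolding lin_def by (rule norm_triangle_le_diff) (simp add: norm_mult algebra_simps)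
  also have "(norm q + norm a) * norm (lins q as v) \<le> K * (K ^ length as * norm v)"
    using Cons assms(2) by (intro mult_mono) auto
  finally show ?case by (simp add: mult.assoc)
qed simp

lemma norm_lins_qcnj_le:
  assumes "\<And>a. a \<in> set as \<Longrightarrow> norm q + norm a \<le> K" "0 \<le> K"
  shows "norm (lins q (map qcnj (rev as)) v) \<le> K ^ length as * norm v"
proof -
  have "norm (lins q (map qcnj (rev as)) v) \<le> K ^ length (map qcnj (rev as)) * norm v"
    by (rule norm_lins_le) (use assms in auto)
  then show ?thesis by simp
qed

text \<open>Telescoping: the lists are exchanged one entry at a time, and each exchange costs at
  most \<open>e\<close> times a power of \<open>K\<close>, a common bound for the norms of the maps
  \<open>lin q a\<close>.\<close>

lemma norm_lins_diff_le:
  fixes e K :: real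
  assumes "list_all2 (\<lambda>a b. norm (a - b) \<le> e) as bs" "1 \<le> K" "0 \<le> e"
    and "\<And>a. a \<in> set as \<union> set bs \<Longrightarrow> norm q + norm a \<le> K"
  shows "norm (lins q as v - lins q bs v) \<le> length as * K ^ length as * e * norm v"
  using assms(1,4)
proof (induction as bs rule: list_all2_induct)
  case (Cons a as b bs)
  define m where "m = length as"
  have len: "length bs = m"
    using Cons.hyps by (simp add: m_def list_all2_lengthD)
  have "norm (lin q a (lins q as v - lins q bs v)) \<le> K * norm (lins q as v - lins q bs v)"
    using norm_lins_le[of "[a]" q K] Cons.prems assms(2) by simp
  also have "\<dots> \<le> K * (m * K ^ m * e * norm v)"
    using Cons assms(2) by (intro mult_left_mono) (auto simp: m_def)
  finally have 1: "norm (lin q a (lins q as v - lins q bs v)) \<le> m * K ^ Suc m * e * norm v"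
    by (simp add: mult_ac)
  have "norm ((a - b) * lins q bs v) \<le> e * (K ^ m * norm v)"
    unfolding norm_mult using Cons assms(2,3) norm_lins_le[of bs q K v] len
    by (intro mult_mono) auto
  \<comment> \<open>The exponent is raised, as K >= 1 permits, so that this term can be added to the
    bound \<open>1\<close>.\<close>
  also have "\<dots> \<le> e * (K ^ Suc m * norm v)"
    using assms(2,3) by (intro mult_left_mono mult_right_mono power_increasing) auto
  finally have 2: "norm ((a - b) * lins q bs v) \<le> K ^ Suc m * e * norm v"
    by (simp add: mult_ac)
  have "lin q a (lins q as v) - lin q b (lins q bs v)
      = lin q a (lins q as v - lins q bs v) - (a - b) * lins q bs v"
    by (simp add: lin_def algebra_simps)
  also have "norm \<dots> \<le> m * K ^ Suc m * e * norm v + K ^ Suc m * e * norm v"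
    using 1 2 by (rule norm_triangle_le_diff[OF add_mono])
  finally show ?case by (simp add: m_def algebra_simps)
qed simp

text \<open>The error from the left factors is multiplied by the factor \<open>x - a\<close>, whose value at \<open>q\<close>
  is itself of order \<open>e\<close>. The error from the right factors has no such gain; it enters linearly,
  which is harmless because those factors have already been updated.\<close>

lemma numerator_error:
  fixes e e' K D :: real and n :: nat
  assumes xl: "list_all2 (\<lambda>a b. norm (a - b) \<le> e) xl zl"
    and xr: "list_all2 (\<lambda>a b. norm (a - b) \<le> e') xr wr"
    and q: "norm (q - a) \<le> e"
    and e: "0 \<le> e" "e \<le> 1" "0 \<le> e'"
    and K: "1 \<le> K" "\<And>b. b \<in> set xl \<union> set zl \<union> set xr \<union> set wr \<union> {a} \<Longrightarrow> norm q + norm b \<le> K"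
    and n: "length xl \<le> n" "length xr \<le> n" "1 \<le> n"
    and D: "D = n * K ^ (2 * n)"
  shows "norm (lins q (map qcnj (rev zl)) (lins q xl (lin q a
             (lins q xr (lins q (map qcnj (rev wr)) 1))))
           - (q - a) * char_prod q wr * char_prod q zl) \<le> 2 * K * D\<^sup>2 * (e\<^sup>2 + e')"
    (is "norm (?l' (lins q xl (lin q a (lins q xr ?v))) - _) \<le> _")
proof -
  have len: "length zl = length xl" "length wr = length xr"
    using xl xr by (simp_all add: list_all2_lengthD)
  \<comment> \<open>\<open>D\<close> absorbs every power of \<open>K\<close> and every list length
    that occurs below.\<close>
  have pow: "K ^ m \<le> D" if "m \<le> 2 * n" for m
  proof -
    have "K ^ m \<le> 1 * K ^ (2 * n)"
      using K(1) that by (simp add: power_increasing)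
    also have "\<dots> \<le> n * K ^ (2 * n)"
      using K(1) n(3) by (intro mult_right_mono) auto
    finally show ?thesis by (simp add: D)
  qed
  have pow': "real l * K ^ m \<le> D" if "l \<le> n" "m \<le> 2 * n" for l m
    unfolding D using K(1) that by (intro mult_mono power_increasing) auto
  have D1: "1 \<le> D" using pow[of 0] by simp
  have v: "norm ?v \<le> K ^ length xr"
    using norm_lins_qcnj_le[of wr q K 1] K len by simp
  \<comment> \<open>Were \<open>wr\<close> the right factors of the polynomial, the conjugate pairs
    would collapse to \<open>r\<close>. Having \<open>xr\<close> there instead costs an error of
    order e'.\<close>
  define r where "r = char_prod q wr"
  have r: "lins q wr ?v = r"
    by (simp add: lins_lins_qcnj r_def)
  have "norm (lins q wr ?v) \<le> K ^ length xr * K ^ length xr"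
    using K len v
    by (auto intro!: order.trans[OF norm_lins_le[of wr q K ?v]] mult_left_mono)
  then have nr: "norm r \<le> D"
    using pow[of "length xr + length xr"] n by (simp add: r power_add)
  define u where "u = lins q xr ?v"
  have "norm (u - r) \<le> length xr * K ^ length xr * e' * norm ?v"
    unfolding u_def r[symmetric] by (rule norm_lins_diff_le[OF xr]) (use K e in auto)
  also have "\<dots> \<le> length xr * K ^ length xr * e' * K ^ length xr"
    using K e v by (intro mult_left_mono) auto
  also have "\<dots> = (length xr * K ^ (length xr + length xr)) * e'"
    by (simp add: power_add mult_ac)
  also have "\<dots> \<le> D * e'"
    using e n by (intro mult_right_mono pow') auto
  finally have ur: "norm (u - r) \<le> D * e'" .
  define s where "s = lin q a u"
  define s0 where "s0 = (q - a) * r"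
  have s0: "s0 = lin q a r"
    by (simp add: s0_def r_def lin_def algebra_simps char_prod_commute)
  have "norm (s - s0) \<le> K * norm (u - r)"
    using norm_lins_le[of "[a]" q K "u - r"] K by (simp add: s_def s0 lin_diff)
  also have "\<dots> \<le> K * (D * e')"
    using ur K by (intro mult_left_mono) auto
  finally have ss0: "norm (s - s0) \<le> K * (D * e')" .
  have ns0: "norm s0 \<le> e * D"
    unfolding s0_def norm_mult using q nr e by (intro mult_mono) auto
  have ns: "norm s \<le> e * D + K * (D * e')"
    using ns0 ss0 norm_triangle_sub[of s s0] by linarith
  have l': "norm (?l' y) \<le> K ^ length xl * norm y" for y
    using norm_lins_qcnj_le[of zl q K y] K len by simp
  have "norm (?l' (lins q xl s - lins q zl s))
      \<le> K ^ length xl * (length xl * K ^ length xl * e * norm s)"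
    using K e norm_lins_diff_le[OF xl, of K q s]
    by (intro order.trans[OF l'] mult_left_mono) auto
  also have "\<dots> = (length xl * K ^ (length xl + length xl)) * (e * norm s)"
    by (simp add: power_add mult_ac)
  also have "\<dots> \<le> D * (e * (e * D + K * (D * e')))"
    using e n ns D1 by (intro mult_mono pow') auto
  finally have A: "norm (?l' (lins q xl s - lins q zl s)) \<le> D * (e * (e * D + K * (D * e')))" .
  have "norm (?l' (lins q zl (s - s0))) \<le> K ^ length xl * (K ^ length xl * norm (s - s0))"
    using K norm_lins_le[of zl q K "s - s0"] len
    by (intro order.trans[OF l'] mult_left_mono) auto
  also have "\<dots> = K ^ (length xl + length xl) * norm (s - s0)"
    by (simp add: power_add mult_ac)
  also have "\<dots> \<le> D * (K * (D * e'))"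
    using ss0 n D1 by (intro mult_mono pow) auto
  finally have B: "norm (?l' (lins q zl (s - s0))) \<le> D * (K * (D * e'))" .
  \<comment> \<open>With \<open>zl\<close> for \<open>xl\<close> and \<open>s0\<close> for
    \<open>s\<close> the conjugate pairs would collapse exactly. The error is split into these two
    replacements.\<close>
  have "?l' (lins q xl s) - s0 * char_prod q zl
      = ?l' (lins q xl s - lins q zl s) + ?l' (lins q zl (s - s0))"
    using lins_qcnj_lins[of q zl s0] by (simp add: lins_diff)
  also have "norm \<dots> \<le> D * (e * (e * D + K * (D * e'))) + D * (K * (D * e'))"
    by (intro norm_triangle_mono A B)
  also have "\<dots> = D\<^sup>2 * e\<^sup>2 + K * D\<^sup>2 * (e * e') + K * D\<^sup>2 * e'"
    by (simp add: power2_eq_square algebra_simps)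
  also have "\<dots> \<le> 2 * K * D\<^sup>2 * e\<^sup>2 + K * D\<^sup>2 * e' + K * D\<^sup>2 * e'"
  proof -
    have "D\<^sup>2 * e\<^sup>2 \<le> (2 * K) * (D\<^sup>2 * e\<^sup>2)"
      using K(1) mult_right_mono[of 1 "2 * K" "D\<^sup>2 * e\<^sup>2"] by simp
    moreover have "K * D\<^sup>2 * (e * e') \<le> K * D\<^sup>2 * (1 * e')"
      using K(1) e by (intro mult_left_mono mult_right_mono) auto
    ultimately show ?thesis by (simp add: mult_ac)
  qed
  also have "\<dots> = 2 * K * D\<^sup>2 * (e\<^sup>2 + e')"
    by (simp add: algebra_simps)
  finally show ?thesis
    by (simp add: s_def u_def s0_def r_def)
qed

text \<open>Only entries of \<open>w\<close> below \<open>i\<close> are read. Hence \<open>w\<close>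
  may be the very family being computed, and a whole sweep is described by the equations
  \<open>w i = step P n z w i\<close>.\<close>

definition step :: "quat poly \<Rightarrow> nat \<Rightarrow> (nat \<Rightarrow> quat) \<Rightarrow> (nat \<Rightarrow> quat) \<Rightarrow> nat \<Rightarrow> quat" where
  "step P n z w i = z i - peval (pcnj (left_part n z i) \<star> P \<star> pcnj (right_part w i)) (z i)
     * inverse (peval (char_part n z w i) (z i))"

lemma factor_product_eq: "factor_product n x = factors (map x (rev [1..<Suc n]))"
  by (simp add: factor_product_def factors_def o_def)

lemma peval_char_part:
  "peval (char_part n z w i) q
   = char_prod q (map w (rev [1..<i])) * char_prod q (map z (rev [Suc i..<Suc n]))"
proof -
  have "char_part n z w i = pprod (map char_poly (map w [1..<i] @ map z [Suc i..<Suc n]))"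
    by (simp only: char_part_def pprod_append map_append map_map o_def)
  then have "peval (char_part n z w i) q = char_prod q (map w [1..<i] @ map z [Suc i..<Suc n])"
    by (simp only: peval_char_prod)
  also have "\<dots> = char_prod q (rev (map w [1..<i])) * char_prod q (rev (map z [Suc i..<Suc n]))"
    by (simp only: char_prod_rev) simp
  finally show ?thesis by (simp add: rev_map)
qed

lemma peval_numerator:
  assumes "i \<in> {1..n}"
  shows "peval (pcnj (left_part n z i) \<star> factor_product n x \<star> pcnj (right_part w i)) q
    = lins q (map qcnj (rev (map z (rev [Suc i..<Suc n])))) (lins q (map x (rev [Suc i..<Suc n]))
        (lin q (x i) (lins q (map x (rev [1..<i]))
          (lins q (map qcnj (rev (map w (rev [1..<i])))) 1))))"
proof -
  have "[1..<Suc n] = [1..<i] @ i # [Suc i..<Suc n]"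
    using assms upt_add_eq_append[of 1 i "Suc n - i"] by (simp add: upt_conv_Cons del: upt_Suc)
  then have fp: "factor_product n x
      = factors (map x (rev [Suc i..<Suc n]) @ x i # map x (rev [1..<i]))"
    by (simp add: factor_product_eq del: upt_Suc)
  have l: "left_part n z i = factors (map z (rev [Suc i..<Suc n]))"
    by (simp add: left_part_def factors_def o_def)
  have r: "right_part w i = factors (map w (rev [1..<i]))"
    by (simp add: right_part_def factors_def o_def)
  show ?thesis
    unfolding fp l r pcnj_factors factors_append[symmetric] peval_factors
    by (simp del: upt_Suc)
qed

text \<open>The errors \<open>e\<close> of the old and \<open>e'\<close> of the already updated
  entries are kept apart so that the bound can be iterated along a sweep.\<close>

lemma step_error:
  assumes sep: "pairwise (\<lambda>i j. char_val (x i) (x j) \<noteq> 0) {1..n}"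
    and n: "1 \<le> n"
  obtains d C where "0 < d" "d \<le> 1" "1 \<le> C"
    "\<forall>z w e e'. \<forall>i\<in>{1..n}. (\<forall>j\<in>{1..n}. norm (z j - x j) \<le> e) \<and> e < d \<and>
        (\<forall>j\<in>{1..<i}. norm (w j - x j) \<le> e') \<and> 0 \<le> e' \<and> e' < d \<longrightarrow>
        peval (char_part n z w i) (z i) \<noteq> 0 \<and>
        norm (step (factor_product n x) n z w i - x i) \<le> C * (e\<^sup>2 + e')"
proof -
  \<comment> \<open>There are finitely many index pairs, so a single \<open>d\<close> works for all
    of them.\<close>
  let ?T = "{p \<in> {1..n} \<times> {1..n}. fst p \<noteq> snd p}"
  have "\<forall>\<^sub>F d in at_right 0. \<forall>p\<in>?T. \<forall>q a. norm (q - x (fst p)) < d \<longrightarrow> norm (a - x (snd p)) < d \<longrightarrow>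
           d \<le> norm (char_val q a)"
    using sep by (intro eventually_ball_finite ballI char_val_lower_bound) (auto simp: pairwise_def)
  moreover have "\<forall>\<^sub>F d in at_right 0. d < (1::real)"
    unfolding eventually_at_right_field by (intro exI[of _ 1]) auto
  moreover have "\<forall>\<^sub>F d in at_right 0. d > (0::real)"
    by (rule eventually_at_right_less)
  ultimately have "\<forall>\<^sub>F d in at_right 0. 0 < d \<and> d < 1 \<and> (\<forall>p\<in>?T. \<forall>q a.
      norm (q - x (fst p)) < d \<longrightarrow> norm (a - x (snd p)) < d \<longrightarrow> d \<le> norm (char_val q a))"
    by eventually_elim blast
  then have "\<exists>d. 0 < d \<and> d < 1 \<and> (\<forall>p\<in>?T. \<forall>q a.
      norm (q - x (fst p)) < d \<longrightarrow> norm (a - x (snd p)) < d \<longrightarrow> d \<le> norm (char_val q a))"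
    by (rule eventually_happens'[OF trivial_limit_at_right_real])
  then obtain d where d: "0 < d" "d < 1" and low': "\<forall>p\<in>?T. \<forall>q a.
      norm (q - x (fst p)) < d \<longrightarrow> norm (a - x (snd p)) < d \<longrightarrow> d \<le> norm (char_val q a)"
    by (elim exE conjE) (rule that)
  have low: "d \<le> norm (char_val q a)"
    if "i \<in> {1..n}" "j \<in> {1..n}" "i \<noteq> j" "norm (q - x i) < d" "norm (a - x j) < d" for i j q a
    using low' that by (auto dest!: bspec[of _ _ "(i, j)"])
  \<comment> \<open>\<open>M\<close> bounds everything within distance 1 of some \<open>x j\<close>,
    so \<open>K = 2 * M\<close> bounds the sums of two norms required by
    \<open>numerator_error\<close>.\<close>
  define M where "M = (\<Sum>j\<in>{1..n}. norm (x j)) + 1"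
  have M: "norm (x j) + 1 \<le> M" if "j \<in> {1..n}" for j
    unfolding M_def using that by (intro add_right_mono member_le_sum) auto
  have M1: "1 \<le> M" by (simp add: M_def sum_nonneg)
  define K where "K = 2 * M"
  define D where "D = n * K ^ (2 * n)"
  have "1 * 1 \<le> D"
    unfolding D_def using n M1 by (intro mult_mono one_le_power) (auto simp: K_def)
  then have D1: "1 \<le> D" by simp
  \<comment> \<open>The bound from \<open>numerator_error\<close>, divided by the lower bound d^n
    for the denominator.\<close>
  define C where "C = 2 * K * D\<^sup>2 / d ^ n"
  have "1 \<le> 2 * K * D\<^sup>2"
    using mult_mono[of 1 "2 * K" 1 "D\<^sup>2"] M1 one_le_power[OF D1, of 2] by (simp add: K_def)
  moreover have dn: "0 < d ^ n" "d ^ n \<le> 1"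
    using d by (auto intro: power_le_one)
  ultimately have C1: "1 \<le> C"
    by (simp add: C_def)
  have "peval (char_part n z w i) (z i) \<noteq> 0 \<and>
        norm (step (factor_product n x) n z w i - x i) \<le> C * (e\<^sup>2 + e')"
    if i: "i \<in> {1..n}" and z_near: "\<forall>j\<in>{1..n}. norm (z j - x j) \<le> e" and e: "e < d"
      and w_near: "\<forall>j\<in>{1..<i}. norm (w j - x j) \<le> e'" and e': "0 \<le> e'" "e' < d"
    for z w i and e e' :: real
  proof -
    note z = bspec[OF z_near] and w = bspec[OF w_near]
    define q where "q = z i"
    define zl xl where "zl = map z (rev [Suc i..<Suc n])" and "xl = map x (rev [Suc i..<Suc n])"
    define wr xr where "wr = map w (rev [1..<i])" and "xr = map x (rev [1..<i])"
    define Q where "Q = char_prod q wr * char_prod q zl"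
    define N where "N = lins q (map qcnj (rev zl)) (lins q xl (lin q (x i)
             (lins q xr (lins q (map qcnj (rev wr)) 1))))"
    have e0: "0 \<le> e" using z[OF i] norm_ge_zero order.trans by blast
    have q: "norm (q - x i) \<le> e" using z[OF i] by (simp add: q_def)
    have nM: "norm a \<le> M" if "norm (a - x j) \<le> 1" "j \<in> {1..n}" for a j
      using that M[of j] norm_triangle_sub[of a "x j"] by linarith
    have qM: "norm q \<le> M" using q e d i by (intro nM) auto
    have lower: "d \<le> norm (char_val q a)" if "a \<in> set (wr @ zl)" for a
    proof -
      have "\<exists>j\<in>{1..n}. j \<noteq> i \<and> norm (a - x j) < d"
      proof -
        have "a \<in> w ` {1..<i} \<union> z ` {Suc i..<Suc n}"
          using that unfolding wr_def zl_def by (auto simp del: upt_Suc)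
        then consider j where "j \<in> {1..<i}" "a = w j" | j where "j \<in> {Suc i..<Suc n}" "a = z j"
          by blast
        then show ?thesis
        proof cases
          case 1
          then show ?thesis using w[of j] e' i by (intro bexI[of _ j]) auto
        next
          case 2
          then show ?thesis using z[of j] e i by (intro bexI[of _ j]) auto
        qed
      qed
      then show ?thesis using low[of i _ q a] i q e by auto
    qed
    \<comment> \<open>There are n - 1 characteristic values, and d < 1.\<close>
    have "d ^ n \<le> d ^ length (wr @ zl)"
      using d i by (intro power_decreasing) (auto simp: wr_def zl_def simp del: upt_Suc)
    also have "\<dots> \<le> norm (char_prod q (wr @ zl))"
      using d lower by (intro norm_char_prod_ge) auto
    finally have Q: "d ^ n \<le> norm Q" by (simp add: Q_def)
    then have Q0: "Q \<noteq> 0" using dn by auto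
    have den: "peval (char_part n z w i) (z i) = Q"
      by (simp add: peval_char_part Q_def q_def wr_def zl_def)
    have num: "peval (pcnj (left_part n z i) \<star> factor_product n x \<star> pcnj (right_part w i)) (z i) = N"
      unfolding peval_numerator[OF i] N_def q_def wr_def zl_def xr_def xl_def by simp
    have "norm (N - (q - x i) * char_prod q wr * char_prod q zl) \<le> 2 * K * D\<^sup>2 * (e\<^sup>2 + e')"
      unfolding N_def
    proof (rule numerator_error)
      show "list_all2 (\<lambda>a b. norm (a - b) \<le> e) xl zl"
        using z i by (auto simp: xl_def zl_def list_all2_map1 list_all2_map2 norm_minus_commute
            list_all2_same simp del: upt_Suc)
      show "list_all2 (\<lambda>a b. norm (a - b) \<le> e') xr wr"
        using w by (auto simp: xr_def wr_def list_all2_map1 list_all2_map2 norm_minus_commute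
            list_all2_same)
      show "1 \<le> K" using M1 by (simp add: K_def)
      show "length xl \<le> n" "length xr \<le> n"
        using i by (auto simp: xl_def xr_def simp del: upt_Suc)
      fix b assume b: "b \<in> set xl \<union> set zl \<union> set xr \<union> set wr \<union> {x i}"
      have "\<exists>j\<in>{1..n}. norm (b - x j) \<le> 1"
      proof -
        have "b \<in> x ` {1..n} \<union> z ` {1..n} \<union> w ` {1..<i}"
          using b i unfolding xl_def zl_def xr_def wr_def by (auto simp del: upt_Suc)
        then consider j where "j \<in> {1..n}" "b = x j" | j where "j \<in> {1..n}" "b = z j"
          | j where "j \<in> {1..<i}" "b = w j"
          by blast
        then show ?thesis
        proof cases
          case 1
          then show ?thesis by (intro bexI[of _ j]) auto
        next
          case 2
          then show ?thesis using z[of j] e d by (intro bexI[of _ j]) auto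
        next
          case 3
          then show ?thesis using w[of j] e' d i by (intro bexI[of _ j]) auto
        qed
      qed
      then have "norm b \<le> M" using nM by blast
      with qM show "norm q + norm b \<le> K" by (simp add: K_def)
    qed (use q e e0 e' d n D_def in auto)
    then have err: "norm (N - (q - x i) * Q) \<le> C * (e\<^sup>2 + e') * d ^ n"
      using d by (simp add: Q_def C_def mult.assoc)
    have "step (factor_product n x) n z w i - x i = q - x i - N * inverse Q"
      by (simp add: step_def num den q_def)
    also have "\<dots> = ((q - x i) * Q - N) * inverse Q"
      using Q0 by (simp add: left_diff_distrib mult.assoc)
    finally have "norm (step (factor_product n x) n z w i - x i)
        = norm (N - (q - x i) * Q) / norm Q"
      by (simp add: norm_mult norm_inverse norm_minus_commute divide_inverse)
    also have "\<dots> \<le> C * (e\<^sup>2 + e') * d ^ n / d ^ n"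
      using err Q dn C1 e' by (intro frac_le) auto
    also have "\<dots> = C * (e\<^sup>2 + e')" using d by simp
    finally show ?thesis
      using Q0 den by simp
  qed
  moreover have "0 < d" "d \<le> 1" using d by auto
  ultimately show thesis
    using C1 that[of d C] by blast
qed

section \<open>Quadratic convergence\<close>

lemma norm_le_max_error: "i \<in> {1..n} \<Longrightarrow> norm (w i - v i) \<le> max_error n w v"
  unfolding max_error_def by (intro Max_ge) auto

lemma max_error_le:
  assumes "1 \<le> n" "\<And>i. i \<in> {1..n} \<Longrightarrow> norm (w i - v i) \<le> e"
  shows "max_error n w v \<le> e"
  unfolding max_error_def using assms by (subst Max_le_iff) auto

lemma max_error_commute: "max_error n w v = max_error n v w"
  by (simp add: max_error_def norm_minus_commute)

lemma max_error_nonneg: "1 \<le> n \<Longrightarrow> 0 \<le> max_error n w v"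
  using order.trans[OF norm_ge_zero norm_le_max_error[of 1 n w v]] by simp

text \<open>Strong induction on \<open>i\<close> bounds the new error of entry \<open>i\<close> by
  (2 C)^i e^2.\<close>

lemma sweep_error:
  assumes sep: "pairwise (\<lambda>i j. char_val (x i) (x j) \<noteq> 0) {1..n}"
    and n: "1 \<le> n"
  obtains d B where "0 < d" "1 \<le> B" "d * B \<le> 1 / 2"
    "\<forall>z w. max_error n x z < d \<and> (\<forall>i\<in>{1..n}. w i = step (factor_product n x) n z w i) \<longrightarrow>
        (\<forall>i\<in>{1..n}. peval (char_part n z w i) (z i) \<noteq> 0) \<and>
        max_error n x w \<le> B * (max_error n x z)\<^sup>2"
proof -
  obtain d0 C where dC: "0 < d0" "d0 \<le> 1" "1 \<le> C"
    and st: "\<forall>z w e e'. \<forall>i\<in>{1..n}. (\<forall>j\<in>{1..n}. norm (z j - x j) \<le> e) \<and> e < d0 \<and>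
        (\<forall>j\<in>{1..<i}. norm (w j - x j) \<le> e') \<and> 0 \<le> e' \<and> e' < d0 \<longrightarrow>
        peval (char_part n z w i) (z i) \<noteq> 0 \<and>
        norm (step (factor_product n x) n z w i - x i) \<le> C * (e\<^sup>2 + e')"
    by (rule step_error[OF sep n])
  define B where "B = (2 * C) ^ n"
  have B1: "1 \<le> B" unfolding B_def using dC by (intro one_le_power) auto
  \<comment> \<open>This makes B e^2 at most e/2 for e < d, so the updated entries stay in the
    region where \<open>step_error\<close> applies.\<close>
  define d where "d = d0 / (2 * B)"
  have d: "0 < d" "d * B \<le> 1 / 2" "d \<le> d0"
    using dC B1 by (auto simp: d_def divide_simps)
  have "(\<forall>i\<in>{1..n}. peval (char_part n z w i) (z i) \<noteq> 0) \<and>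
        max_error n x w \<le> B * (max_error n x z)\<^sup>2"
    if e: "max_error n x z < d"
      and w_step: "\<forall>i\<in>{1..n}. w i = step (factor_product n x) n z w i" for z w
  proof -
    note w = bspec[OF w_step]
    define e where "e = max_error n x z"
    have e0: "0 \<le> e" "e < d" using max_error_nonneg n e by (auto simp: e_def)
    have z: "norm (z j - x j) \<le> e" if "j \<in> {1..n}" for j
      using norm_le_max_error[OF that, of x z] by (simp add: e_def norm_minus_commute)
    have "peval (char_part n z w i) (z i) \<noteq> 0 \<and> norm (w i - x i) \<le> (2 * C) ^ i * e\<^sup>2"
      if "i \<in> {1..n}" for i
      using that
    proof (induction i rule: less_induct)
      case (less i)
      let ?e' = "(2 * C) ^ (i - 1) * e\<^sup>2"
      have w': "norm (w j - x j) \<le> ?e'" if "j \<in> {1..<i}" for j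
      proof -
        have "norm (w j - x j) \<le> (2 * C) ^ j * e\<^sup>2"
          using less that by auto
        also have "\<dots> \<le> ?e'"
          using that dC by (intro mult_right_mono power_increasing) auto
        finally show ?thesis .
      qed
      have "?e' \<le> B * e\<^sup>2"
        unfolding B_def using less.prems dC by (intro mult_right_mono power_increasing) auto
      also have "B * e\<^sup>2 \<le> e / 2"
      proof -
        have "(e * B) * e \<le> (d * B) * e"
          using e0 B1 by (intro mult_right_mono) auto
        also have "\<dots> \<le> (1 / 2) * e"
          using d e0 by (intro mult_right_mono) auto
        finally show ?thesis by (simp add: power2_eq_square mult_ac)
      qed
      also have "\<dots> < d0" using e0 d dC by linarith
      finally have "?e' < d0" .
      then have *: "peval (char_part n z w i) (z i) \<noteq> 0 \<and> norm (w i - x i) \<le> C * (e\<^sup>2 + ?e')"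
        using st[rule_format, of i z e w ?e'] less.prems z w' e0 d dC w[of i] by auto
      \<comment> \<open>As e^2 is at most \<open>?e'\<close>, the bound is at most 2 C times
        \<open>?e'\<close>, which raises the exponent from i - 1 to i. For i = 1, \<open>?e'\<close>
        is e^2 and there is no updated entry to bound.\<close>
      have "1 \<le> (2 * C) ^ (i - 1)" using dC by (intro one_le_power) auto
      then have "1 * e\<^sup>2 \<le> ?e'" by (intro mult_right_mono) auto
      then have "C * (e\<^sup>2 + ?e') \<le> C * (?e' + ?e')"
        using dC by (intro mult_left_mono add_right_mono) auto
      also have "\<dots> = (2 * C) ^ i * e\<^sup>2"
        using less.prems by (cases i) (auto simp: algebra_simps)
      finally show ?case using * by linarith
    qed note main = this
    have "max_error n x w \<le> B * e\<^sup>2"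
    proof (rule max_error_le[OF n])
      fix i assume i: "i \<in> {1..n}"
      have "norm (w i - x i) \<le> (2 * C) ^ i * e\<^sup>2" using main i by blast
      also have "\<dots> \<le> B * e\<^sup>2"
        unfolding B_def using i dC by (intro mult_right_mono power_increasing) auto
      finally show "norm (x i - w i) \<le> B * e\<^sup>2" by (simp add: norm_minus_commute)
    qed
    with main show ?thesis
      by (simp add: e_def)
  qed
  then show thesis
    using d B1 that[of d B] by blast
qed

theorem theorem5:
  fixes P :: "quat poly" and n :: nat and x :: "nat \<Rightarrow> quat"
  assumes "n \<ge> 1"
    and "degree P = n"
    and "lead_coeff P = 1"
    and "simple_roots P"
    and "P = factor_product n x"
  shows "\<exists>\<delta>>0. \<forall>z0 :: nat \<Rightarrow> quat. max_error n z0 x < \<delta> \<longrightarrow>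
           (\<forall>k. \<forall>i\<in>{1..n}. denominator P n z0 k i \<noteq> 0) \<and>
           converges_quadratically n (iterate P n z0) x"
proof -
  have sep: "pairwise (\<lambda>i j. char_val (x i) (x j) \<noteq> 0) {1..n}"
    using assms by (intro simple_roots_pairwise_char_val[of P]) (simp_all only: factor_product_eq)
  obtain d B where d: "0 < d" "1 \<le> B" "d * B \<le> 1 / 2"
    and sweep: "\<forall>z w. max_error n x z < d \<and> (\<forall>i\<in>{1..n}. w i = step P n z w i) \<longrightarrow>
        (\<forall>i\<in>{1..n}. peval (char_part n z w i) (z i) \<noteq> 0) \<and>
        max_error n x w \<le> B * (max_error n x z)\<^sup>2"
    by (rule sweep_error[OF sep \<open>n \<ge> 1\<close>, folded \<open>P = factor_product n x\<close>])
  show ?thesis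
  proof (intro exI[of _ d] conjI allI ballI impI d(1))
    fix z0
    assume z0: "max_error n z0 x < d"
    define E where "E k = max_error n x (iterate P n z0 k)" for k
    have E0: "0 \<le> E k" for k using max_error_nonneg \<open>n \<ge> 1\<close> by (simp add: E_def)
    \<comment> \<open>The recursion defining \<open>iterate\<close> is the system of sweep equations
      for rounds \<open>k\<close> and \<open>Suc k\<close>.\<close>
    have sw: "(\<forall>i\<in>{1..n}. denominator P n z0 k i \<noteq> 0) \<and> E (Suc k) \<le> B * (E k)\<^sup>2"
      if "E k < d" for k
      unfolding E_def denominator_def using that
      by (intro sweep[rule_format]) (simp_all add: E_def step_def)
    have half: "B * (E k)\<^sup>2 \<le> E k / 2" if "E k < d" for k
    proof -
      have "(E k * B) * E k \<le> (d * B) * E k"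
        using that d E0 by (intro mult_right_mono) auto
      also have "\<dots> \<le> (1 / 2) * E k"
        using d E0 by (intro mult_right_mono) auto
      finally show ?thesis by (simp add: power2_eq_square mult_ac)
    qed
    \<comment> \<open>Halving keeps the error below \<open>d\<close>, so that the next sweep is
      controlled, and also gives the geometric bound that yields convergence.\<close>
    have "E k < d \<and> E k \<le> d * (1 / 2) ^ k" for k
    proof (induction k)
      case 0
      have "iterate P n z0 0 = z0" by (rule ext) simp
      with z0 show ?case by (simp add: E_def max_error_commute)
    next
      case (Suc k)
      then have "E (Suc k) \<le> E k / 2" using sw[of k] half[of k] by simp
      with Suc E0[of k] show ?case by simp
    qed
    then have Ed: "E k < d" and Epow: "E k \<le> d * (1 / 2) ^ k" for k by blast+
    show "denominator P n z0 k i \<noteq> 0" if "i \<in> {1..n}" for k i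
      using sw[OF Ed] that by blast
    have "(\<lambda>k. d * (1 / 2) ^ k) \<longlonglongrightarrow> d * 0"
      by (intro tendsto_intros LIMSEQ_power_zero) auto
    then have lim: "(\<lambda>k. d * (1 / 2) ^ k) \<longlonglongrightarrow> 0" by simp
    have "(\<lambda>k. iterate P n z0 k i) \<longlonglongrightarrow> x i" if "i \<in> {1..n}" for i
    proof (rule Lim_transform_bound[OF _ lim, THEN LIM_zero_cancel])
      have "norm (iterate P n z0 k i - x i) \<le> d * (1 / 2) ^ k" for k
        using norm_le_max_error[OF that, of x "iterate P n z0 k"] Epow[of k]
        by (simp add: E_def norm_minus_commute)
      then show "\<forall>\<^sub>F k in sequentially. norm (iterate P n z0 k i - x i) \<le> norm (d * (1 / 2) ^ k)"
        using d by (simp add: abs_mult)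
    qed
    moreover have "\<forall>k. E (Suc k) \<le> B * (E k)\<^sup>2" using sw Ed by blast
    ultimately show "converges_quadratically n (iterate P n z0) x"
      unfolding converges_quadratically_def E_def by blast
  qed
qed

end
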